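(* Let $r\ge1$ be an integer. The sequences $\{F^{(r)}_{n+1}\}_{n\in\mathbb Z}$ and $\{L^{(r)}_n\}_{n\in\mathbb Z}$ have the initial values $$F^{(r)}_1=1,\qquad F^{(r)}_0=F^{(r)}_{-1}=\cdots=F^{(r)}_{-r+2}=0$$ (i.e. $F_1^{(r)}=1$ and $F^{(r)}_{-i}=0$ for $0\le i\le r-2$), and, for $n=0,1,\dots,r-1$, $$L^{(r)}_n=\begin{cases}-2^{2m-1}+\frac{2r+1}{2}\binom{2m}{m}&(n=2m)\\4^m&(n=2m+1).\end{cases}$$ Moreover both sequences, $a^{(r)}_n=F^{(r)}_{n+1}$ and $a^{(r)}_n=L^{(r)}_n$, satisfy the same recursion: for all $n\in\mathbb Z$, $$a^{(r)}_{n+r}=\sum_{j=0}^{\left\lfloor\frac{r-1}{2}\right\rfloor}(-1)^j\binom{r-1-j}{j}a^{(r)}_{n+r-1-2j}+\sum_{j=0}^{\left\lfloor\frac{r-2}{2}\right\rfloor}(-1)^j\binom{r-1-j}{j+1}a^{(r)}_{n+r-2-2j}.$$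
   Context: For $r\ge1$ put $\alpha_j=-2\cos\left(\frac{2\pi j}{2r+1}\right)$, $j=1,\dots,r$; these are pairwise distinct and non-zero. For $n\ge0$, $F^{(r)}_{n+1}:=h^{(r)}_n(\alpha_1,\dots,\alpha_r)$, where $h^{(r)}_n(w_1,\dots,w_r)=\sum_{m_1+\dots+m_r=n}w_1^{m_1}\cdots w_r^{m_r}$ (sum over non-negative integers $m_i$), which equals the Schur function $s_{(n)}=s_{(n,0,\dots,0)}$. The definition is extended to all $n\in\mathbb Z$ by $F^{(r)}_{n+1}:=s_{(n,0,\dots,0)}(\alpha_1,\dots,\alpha_r)$, where for $\lambda=(\lambda_1,\dots,\lambda_r)$ $$s_\lambda(w_1,\dots,w_r)=\frac{\det\left(w_i^{\lambda_j+r-j}\right)_{i,j=1,\dots,r}}{\prod_{1\le i<j\le r}(w_i-w_j)}.$$ For $n\in\mathbb Z$, $L^{(r)}_n:=\sum_{j=1}^r\alpha_j^n$. Sums whose upper limit is smaller than their lower limit are empty; $\lfloor x\rfloor$ is the greatest integer not exceeding $x$. *)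

theory Defs
  imports Complex_Main "HOL-Library.FuncSet" "Jordan_Normal_Form.Determinant"
begin

definition complete_hom :: "nat \<Rightarrow> nat \<Rightarrow> (nat \<Rightarrow> 'a::comm_semiring_1) \<Rightarrow> 'a" where
  "complete_hom r n w =
     (\<Sum>m\<in>{m \<in> {1..r} \<rightarrow>\<^sub>E (UNIV :: nat set). (\<Sum>i=1..r. m i) = n}. \<Prod>i=1..r. w i ^ m i)"

text \<open>Matrix indices start at 0, so the entry in row \<open>i\<close> and column \<open>j\<close> uses \<open>w (i + 1)\<close>
  and \<open>lam (j + 1)\<close>. The entries of \<open>lam\<close> may be negative.\<close>

definition schur :: "nat \<Rightarrow> (nat \<Rightarrow> int) \<Rightarrow> (nat \<Rightarrow> 'a::field) \<Rightarrow> 'a" where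
  "schur r lam w =
     det (mat r r (\<lambda>(i, j). w (i + 1) powi (lam (j + 1) + int r - int (j + 1))))
     / (\<Prod>(i, j)\<in>{(i, j). 1 \<le> i \<and> i < j \<and> j \<le> r}. w i - w j)"

definition alpha :: "nat \<Rightarrow> nat \<Rightarrow> real" where
  "alpha r j = - 2 * cos (2 * pi * real j / (2 * real r + 1))"

definition F_seq :: "nat \<Rightarrow> int \<Rightarrow> real" where
  "F_seq r n = schur r (\<lambda>j. if j = 1 then n - 1 else 0) (alpha r)"

definition L_seq :: "nat \<Rightarrow> int \<Rightarrow> real" where
  "L_seq r n = (\<Sum>j=1..r. alpha r j powi n)"

lemma alpha_inj_on: "inj_on (alpha r) {1..r}"
proof (rule inj_onI)
  fix i j assume ij: "i \<in> {1..r}" "j \<in> {1..r}" and eq: "alpha r i = alpha r j"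
  have b: "0 \<le> 2 * pi * real k / (2 * real r + 1) \<and> 2 * pi * real k / (2 * real r + 1) \<le> pi"
    if "k \<in> {1..r}" for k
  proof -
    have "2 * real k / (2 * real r + 1) \<le> 1" using that by (simp add: field_simps)
    hence "pi * (2 * real k / (2 * real r + 1)) \<le> pi * 1" by (intro mult_left_mono) auto
    thus ?thesis by (simp add: mult_ac)
  qed
  have "2 * pi * real i / (2 * real r + 1) = 2 * pi * real j / (2 * real r + 1)"
    by (rule cos_inj_pi) (use b ij eq in \<open>auto simp: alpha_def\<close>)
  moreover have "2 * real r + 1 > 0" by simp
  ultimately show "i = j" by (auto simp: field_simps)
qed

lemma alpha_nonzero: "alpha r j \<noteq> 0"
proof
  assume "alpha r j = 0"
  hence "cos (2 * pi * real j / (2 * real r + 1)) = 0" by (simp add: alpha_def)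
  then obtain i :: int where "odd i" and i: "2 * pi * real j / (2 * real r + 1) = of_int i * (pi / 2)"
    by (auto simp: cos_zero_iff_int)
  have p: "2 * real r + 1 > 0" by simp
  have "pi * (4 * real j) = pi * (of_int i * (2 * real r + 1))"
    using i p by (simp add: field_simps)
  hence "4 * real j = of_int i * (2 * real r + 1)"
    by (metis mult_cancel_left pi_neq_zero)
  hence "of_int (4 * int j) = (of_int (i * (2 * int r + 1)) :: real)" by simp
  hence "4 * int j = i * (2 * int r + 1)" by (subst (asm) of_int_eq_iff)
  moreover have "odd (i * (2 * int r + 1))" using \<open>odd i\<close> by simp
  moreover have "even (4 * int j)" by simp
  ultimately show False by simp
qed

definition col_cof :: "nat \<Rightarrow> (nat \<Rightarrow> 'a::field) \<Rightarrow> nat \<Rightarrow> 'a" where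
  "col_cof k u i = (-1) ^ i *
     det (mat k k (\<lambda>(i', j'). u (if i' < i then i' else Suc i') ^ (k - Suc j')))"

lemma det_first_col:
  "det (mat (Suc k) (Suc k) (\<lambda>(i, j). if j = 0 then f (u i) else u i ^ (k - j)))
   = (\<Sum>i<Suc k. f (u i) * col_cof k u i)" (is "det ?A = _")
proof -
  have "det ?A = (\<Sum>i<Suc k. ?A $$ (i, 0) * cofactor ?A i 0)"
    by (rule laplace_expansion_column) auto
  also have "\<dots> = (\<Sum>i<Suc k. f (u i) * col_cof k u i)"
  proof (rule sum.cong[OF refl])
    fix i assume i: "i \<in> {..<Suc k}"
    have "mat_delete ?A i 0 = mat k k (\<lambda>(i', j'). u (if i' < i then i' else Suc i') ^ (k - Suc j'))"
      by (rule eq_matI) (use i in \<open>auto simp: mat_delete_def\<close>)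
    with i show "?A $$ (i, 0) * cofactor ?A i 0 = f (u i) * col_cof k u i"
      by (simp add: cofactor_def col_cof_def)
  qed
  finally show ?thesis .
qed

lemma col_cof_low_power:
  assumes "e < k"
  shows "(\<Sum>i<Suc k. u i ^ e * col_cof k u i) = 0"
proof -
  have "det (mat (Suc k) (Suc k) (\<lambda>(i, j). if j = 0 then u i ^ e else u i ^ (k - j))) = 0"
    by (rule det_identical_columns[of _ "Suc k" 0 "k - e"])
       (use assms in \<open>auto intro!: eq_vecI\<close>)
  thus ?thesis using det_first_col[of k "\<lambda>x. x ^ e" u] by simp
qed

lemma col_cof_poly:
  assumes "degree p \<le> k"
  shows "(\<Sum>i<Suc k. poly p (u i) * col_cof k u i)
       = coeff p k * (\<Sum>i<Suc k. u i ^ k * col_cof k u i)"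
proof -
  have e: "poly p x = (\<Sum>e\<le>k. coeff p e * x ^ e)" for x
    unfolding poly_altdef
    by (rule sum.mono_neutral_left) (use assms in \<open>auto simp: coeff_eq_0\<close>)
  have "(\<Sum>i<Suc k. poly p (u i) * col_cof k u i)
      = (\<Sum>i<Suc k. \<Sum>e\<le>k. coeff p e * (u i ^ e * col_cof k u i))"
    by (simp only: e sum_distrib_right mult.assoc)
  also have "\<dots> = (\<Sum>e\<le>k. coeff p e * (\<Sum>i<Suc k. u i ^ e * col_cof k u i))"
    by (subst sum.swap) (simp only: sum_distrib_left)
  also have "\<dots> = (\<Sum>e\<in>{k}. coeff p e * (\<Sum>i<Suc k. u i ^ e * col_cof k u i))"
    by (rule sum.mono_neutral_right) (use col_cof_low_power[of _ k u] in auto)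
  finally show ?thesis by simp
qed

lemma prod_linear_coeff:
  fixes u :: "nat \<Rightarrow> 'a::field"
  assumes "finite A"
  shows "degree (\<Prod>j\<in>A. [:- u j, 1:]) = card A" "coeff (\<Prod>j\<in>A. [:- u j, 1:]) (card A) = 1"
proof -
  show d: "degree (\<Prod>j\<in>A. [:- u j, 1:]) = card A"
    by (subst degree_prod_eq_sum_degree) auto
  have "lead_coeff (\<Prod>j\<in>A. [:- u j, 1:]) = 1"
    by (simp add: lead_coeff_prod)
  thus "coeff (\<Prod>j\<in>A. [:- u j, 1:]) (card A) = 1" using d by simp
qed

lemma col_cof_diff_prod:
  assumes "i \<le> k"
  shows "(\<Prod>j\<in>{..k} - {i}. u i - u j) * col_cof k u i = (\<Sum>i<Suc k. u i ^ k * col_cof k u i)"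
proof -
  define p where "p = (\<Prod>j\<in>{..k} - {i}. [:- u j, 1:])"
  have c: "card ({..k} - {i}) = k" using assms by simp
  have p: "degree p = k" "coeff p k = 1"
    using prod_linear_coeff[of "{..k} - {i}" u] unfolding c p_def by auto
  have pv: "poly p x = (\<Prod>j\<in>{..k} - {i}. x - u j)" for x
    by (simp add: p_def poly_prod)
  have "(\<Sum>i'<Suc k. poly p (u i') * col_cof k u i')
      = (\<Sum>i'\<in>{i}. poly p (u i') * col_cof k u i')"
  proof (rule sum.mono_neutral_right)
    show "\<forall>i'\<in>{..<Suc k} - {i}. poly p (u i') * col_cof k u i' = 0"
      by (auto simp: pv)
  qed (use assms in auto)
  with col_cof_poly[of p k u] p show ?thesis by (simp add: pv)
qed

definition diff_prod :: "nat \<Rightarrow> (nat \<Rightarrow> 'a::field) \<Rightarrow> 'a" where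
  "diff_prod r u = (\<Prod>(i, j)\<in>{(i, j). i < j \<and> j < r}. u i - u j)"

lemma finite_pairs: "finite {(i, j). i < j \<and> j < (r :: nat)}"
  by (rule finite_subset[of _ "{..<r} \<times> {..<r}"]) auto

lemma diff_prod_Suc:
  "diff_prod (Suc k) u = (\<Prod>j\<in>{..k} - {0}. u 0 - u j) * diff_prod k (\<lambda>i. u (Suc i))"
proof -
  let ?g = "\<lambda>(i, j). u i - u j"
  let ?P = "{(i, j). i < j \<and> j < k}"
  have s: "{(i, j). i < j \<and> j < Suc k} = Pair 0 ` ({..k} - {0}) \<union> map_prod Suc Suc ` ?P"
  proof (intro equalityI subsetI)
    fix x assume x: "x \<in> {(i, j). i < j \<and> j < Suc k}"
    obtain i j where ij: "x = (i, j)" by (cases x)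
    show "x \<in> Pair 0 ` ({..k} - {0}) \<union> map_prod Suc Suc ` ?P"
    proof (cases i)
      case 0
      thus ?thesis using x ij by auto
    next
      case (Suc i')
      then obtain j' where "j = Suc j'" using x ij by (cases j) auto
      thus ?thesis using x ij Suc by (intro UnI2 image_eqI[of _ _ "(i', j')"]) auto
    qed
  qed auto
  have "diff_prod (Suc k) u = prod ?g (Pair 0 ` ({..k} - {0})) * prod ?g (map_prod Suc Suc ` ?P)"
    unfolding diff_prod_def s
    by (rule prod.union_disjoint) (auto intro: finite_imageI finite_pairs)
  also have "prod ?g (Pair 0 ` ({..k} - {0})) = (\<Prod>j\<in>{..k} - {0}. u 0 - u j)"
    by (subst prod.reindex) (auto simp: inj_on_def)
  also have "prod ?g (map_prod Suc Suc ` ?P) = diff_prod k (\<lambda>i. u (Suc i))"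
    unfolding diff_prod_def
    by (subst prod.reindex) (auto simp: inj_on_def intro!: prod.cong)
  finally show ?thesis .
qed

lemma vandermonde_det:
  "det (mat k k (\<lambda>(i, j). u i ^ (k - Suc j))) = diff_prod k u"
proof (induction k arbitrary: u)
  case 0
  show ?case by (simp add: diff_prod_def)
next
  case (Suc k)
  have "mat (Suc k) (Suc k) (\<lambda>(i, j). u i ^ (Suc k - Suc j))
      = mat (Suc k) (Suc k) (\<lambda>(i, j). if j = 0 then u i ^ k else u i ^ (k - j))"
    by (rule eq_matI) auto
  hence "det (mat (Suc k) (Suc k) (\<lambda>(i, j). u i ^ (Suc k - Suc j)))
      = (\<Sum>i<Suc k. u i ^ k * col_cof k u i)"
    using det_first_col[of k "\<lambda>x. x ^ k" u] by simp
  also have "\<dots> = (\<Prod>j\<in>{..k} - {0}. u 0 - u j) * col_cof k u 0"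
    by (rule col_cof_diff_prod[symmetric]) simp
  also have "col_cof k u 0 = diff_prod k (\<lambda>i. u (Suc i))"
    using Suc.IH[of "\<lambda>i. u (Suc i)"] by (simp add: col_cof_def)
  finally show ?case by (simp only: diff_prod_Suc)
qed

lemma diff_prod_nonzero:
  assumes "inj_on u {..<r}"
  shows "diff_prod r u \<noteq> 0"
proof -
  have "u i \<noteq> u j" if "i < j" "j < r" for i j
    using inj_onD[OF assms, of i j] that by auto
  thus ?thesis unfolding diff_prod_def using finite_pairs[of r] by (auto simp: prod_zero_iff)
qed

lemma det_first_col_eq:
  assumes "inj_on u {..k}"
  shows "det (mat (Suc k) (Suc k) (\<lambda>(i, j). if j = 0 then f (u i) else u i ^ (k - j)))
           / diff_prod (Suc k) u
       = (\<Sum>i\<le>k. f (u i) / (\<Prod>j\<in>{..k} - {i}. u i - u j))"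
proof -
  have V: "(\<Sum>i<Suc k. u i ^ k * col_cof k u i) = diff_prod (Suc k) u"
  proof -
    have "mat (Suc k) (Suc k) (\<lambda>(i, j). u i ^ (Suc k - Suc j))
        = mat (Suc k) (Suc k) (\<lambda>(i, j). if j = 0 then u i ^ k else u i ^ (k - j))"
      by (rule eq_matI) auto
    thus ?thesis
      using det_first_col[of k "\<lambda>x. x ^ k" u] vandermonde_det[of "Suc k" u] by simp
  qed
  have nz: "diff_prod (Suc k) u \<noteq> 0"
    using assms by (intro diff_prod_nonzero) (simp add: lessThan_Suc_atMost)
  have c: "f (u i) * col_cof k u i / diff_prod (Suc k) u
         = f (u i) / (\<Prod>j\<in>{..k} - {i}. u i - u j)" if "i \<le> k" for i
  proof -
    have e: "(\<Prod>j\<in>{..k} - {i}. u i - u j) * col_cof k u i = diff_prod (Suc k) u"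
      using col_cof_diff_prod[OF that, of u] V by (simp only:)
    have "(\<Prod>j\<in>{..k} - {i}. u i - u j) \<noteq> 0"
      using nz e by (metis mult_zero_left)
    moreover have "col_cof k u i \<noteq> 0"
      using nz e by (metis mult_zero_right)
    ultimately show ?thesis unfolding e[symmetric] by simp
  qed
  show ?thesis
    unfolding det_first_col sum_divide_distrib lessThan_Suc_atMost
    by (rule sum.cong) (auto simp: c)
qed

lemma schur_row:
  fixes w :: "nat \<Rightarrow> 'a::field"
  assumes "inj_on w {1..Suc k}"
  shows "schur (Suc k) (\<lambda>j. if j = 1 then n else 0) w
       = (\<Sum>i=1..Suc k. w i powi (n + int k) / (\<Prod>j\<in>{1..Suc k} - {i}. w i - w j))"
proof -
  define u where "u = (\<lambda>i. w (Suc i))"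
  have im: "Suc ` {..k} = {1..Suc k}"
    using image_Suc_atMost by simp
  have inj: "inj_on u {..k}"
    using assms unfolding u_def im[symmetric] by (auto simp: inj_on_def)
  have D: "(\<Prod>(i, j)\<in>{(i, j). 1 \<le> i \<and> i < j \<and> j \<le> Suc k}. w i - w j) = diff_prod (Suc k) u"
    unfolding diff_prod_def u_def
  proof (rule prod.reindex_bij_witness[of _ "map_prod Suc Suc" "map_prod (\<lambda>i. i - 1) (\<lambda>i. i - 1)"])
  qed auto
  have M: "mat (Suc k) (Suc k)
       (\<lambda>(i, j). w (i + 1) powi ((if j + 1 = 1 then n else 0) + int (Suc k) - int (j + 1)))
     = mat (Suc k) (Suc k) (\<lambda>(i, j). if j = 0 then u i powi (n + int k) else u i ^ (k - j))"
  proof (rule eq_matI, goal_cases)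
    case (1 i j)
    show ?case
    proof (cases "j = 0")
      case False
      have "int (Suc k) - int (j + 1) = int (k - j)" using 1 by auto
      hence "w (i + 1) powi (int (Suc k) - int (j + 1)) = w (i + 1) ^ (k - j)"
        by (simp only: power_int_of_nat)
      thus ?thesis using 1 False by (simp add: u_def)
    qed (use 1 in \<open>simp add: u_def add.commute\<close>)
  qed auto
  have "schur (Suc k) (\<lambda>j. if j = 1 then n else 0) w
      = (\<Sum>i\<le>k. u i powi (n + int k) / (\<Prod>j\<in>{..k} - {i}. u i - u j))"
    unfolding schur_def D M by (rule det_first_col_eq[OF inj])
  also have "\<dots> = (\<Sum>i=1..Suc k. w i powi (n + int k) / (\<Prod>j\<in>{1..Suc k} - {i}. w i - w j))"
  proof -
    have "(\<Prod>j\<in>{1..Suc k} - {Suc i}. w (Suc i) - w j) = (\<Prod>j\<in>{..k} - {i}. u i - u j)" for i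
    proof -
      have "{1..Suc k} - {Suc i} = Suc ` ({..k} - {i})"
        unfolding im[symmetric] by auto
      thus ?thesis by (simp add: prod.reindex u_def)
    qed
    thus ?thesis unfolding im[symmetric] by (simp add: sum.reindex u_def)
  qed
  finally show ?thesis .
qed

lemma schur_row_Suc:
  fixes w :: "nat \<Rightarrow> 'a::field"
  assumes "inj_on w {1..Suc (Suc k)}" "n + int k \<ge> 0"
  shows "schur (Suc (Suc k)) (\<lambda>j. if j = 1 then n else 0) w
       = schur (Suc k) (\<lambda>j. if j = 1 then n else 0) w
         + w (Suc (Suc k)) * schur (Suc (Suc k)) (\<lambda>j. if j = 1 then n - 1 else 0) w"
proof -
  let ?R = "Suc (Suc k)"
  let ?d = "\<lambda>i. \<Prod>j\<in>{1..?R} - {i}. w i - w j"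
  have i1: "inj_on w {1..Suc k}" by (rule inj_on_subset[OF assms(1)]) auto
  have "schur ?R (\<lambda>j. if j = 1 then n else 0) w
      - w ?R * schur ?R (\<lambda>j. if j = 1 then n - 1 else 0) w
      = (\<Sum>i=1..?R. (w i - w ?R) * w i powi (n + int k) / ?d i)"
  proof -
    have "w i powi (n + int (Suc k)) = w i * w i powi (n + int k)" for i
    proof -
      have "n + int (Suc k) = int (Suc (nat (n + int k)))" "n + int k = int (nat (n + int k))"
        using assms(2) by auto
      thus ?thesis by (metis power_Suc power_int_of_nat)
    qed
    thus ?thesis
      unfolding schur_row[OF assms(1)] sum_distrib_left sum_subtractf[symmetric]
      by (intro sum.cong) (auto simp: diff_divide_distrib left_diff_distrib)
  qed
  also have "\<dots> = (\<Sum>i=1..Suc k. (w i - w ?R) * w i powi (n + int k) / ?d i)"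
    by simp
  also have "\<dots> = (\<Sum>i=1..Suc k. w i powi (n + int k) / (\<Prod>j\<in>{1..Suc k} - {i}. w i - w j))"
  proof (rule sum.cong[OF refl])
    fix i assume i: "i \<in> {1..Suc k}"
    have "{1..?R} - {i} = insert ?R ({1..Suc k} - {i})" using i by auto
    hence "?d i = (w i - w ?R) * (\<Prod>j\<in>{1..Suc k} - {i}. w i - w j)" by simp
    moreover have "w i - w ?R \<noteq> 0" using inj_onD[OF assms(1), of i ?R] i by auto
    ultimately show "(w i - w ?R) * w i powi (n + int k) / ?d i
        = w i powi (n + int k) / (\<Prod>j\<in>{1..Suc k} - {i}. w i - w j)" by simp
  qed
  finally show ?thesis unfolding schur_row[OF i1] by (simp add: algebra_simps)
qed

lemma schur_row_minus_one:
  fixes w :: "nat \<Rightarrow> 'a::field"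
  shows "schur (Suc (Suc k)) (\<lambda>j. if j = 1 then - 1 else 0) w = 0"
proof -
  have "det (mat (Suc (Suc k)) (Suc (Suc k)) (\<lambda>(i, j). w (i + 1) powi
      ((if j + 1 = 1 then - 1 else 0) + int (Suc (Suc k)) - int (j + 1)))) = 0"
    by (rule det_identical_columns[of _ "Suc (Suc k)" 0 1]) (auto intro!: eq_vecI)
  thus ?thesis unfolding schur_def by simp
qed

lemma finite_comp: "finite {m \<in> {1..r :: nat} \<rightarrow>\<^sub>E (UNIV :: nat set). (\<Sum>i=1..r. m i) = n}"
proof (rule finite_subset)
  show "{m \<in> {1..r} \<rightarrow>\<^sub>E (UNIV :: nat set). (\<Sum>i=1..r. m i) = n} \<subseteq> {1..r} \<rightarrow>\<^sub>E {..n}"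
  proof
    fix m assume m: "m \<in> {m \<in> {1..r} \<rightarrow>\<^sub>E (UNIV :: nat set). (\<Sum>i=1..r. m i) = n}"
    have "m i \<le> n" if "i \<in> {1..r}" for i
    proof -
      have "m i \<le> (\<Sum>i=1..r. m i)" by (rule member_le_sum) (use that in auto)
      thus ?thesis using m by simp
    qed
    thus "m \<in> {1..r} \<rightarrow>\<^sub>E {..n}" using m by (auto simp: PiE_iff)
  qed
qed (auto intro: finite_PiE)

lemma complete_hom_Suc:
  "complete_hom (Suc r) n w =
     complete_hom r n w + (if n = 0 then 0 else w (Suc r) * complete_hom (Suc r) (n - 1) w)"
proof -
  define S where "S = (\<lambda>(r :: nat) n. {m \<in> {1..r} \<rightarrow>\<^sub>E (UNIV :: nat set). (\<Sum>i=1..r. m i) = n})"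
  define A where "A = {m \<in> S (Suc r) n. m (Suc r) = 0}"
  define B where "B = {m \<in> S (Suc r) n. m (Suc r) \<noteq> 0}"
  define g where "g = (\<lambda>m. (\<Prod>i=1..r. w i ^ m i) * w (Suc r) ^ m (Suc r))"
  have S: "m \<in> S r n \<longleftrightarrow> (\<forall>i. i \<notin> {1..r} \<longrightarrow> m i = undefined) \<and> (\<Sum>i=1..r. m i) = n" for m r n
    by (auto simp: S_def PiE_iff extensional_def)
  have s_upd: "(\<Sum>i=1..r. (m(Suc r := c)) i) = (\<Sum>i=1..r. m i)" for m :: "nat \<Rightarrow> nat" and c
    by (rule sum.cong) auto
  have p_upd: "(\<Prod>i=1..r. w i ^ (m(Suc r := c)) i) = (\<Prod>i=1..r. w i ^ m i)"
    for m :: "nat \<Rightarrow> nat" and c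
    by (rule prod.cong) auto
  have s_Suc: "(\<Sum>i=1..Suc r. m i) = (\<Sum>i=1..r. m i) + m (Suc r)" for m :: "nat \<Rightarrow> nat"
    by (rule sum.cl_ivl_Suc[THEN trans]) simp
  have ch: "complete_hom (Suc r) k w = sum g (S (Suc r) k)" for k
    unfolding complete_hom_def S_def g_def by (rule sum.cong) auto
  have un: "S (Suc r) n = A \<union> B" unfolding A_def B_def by blast
  have fin: "finite (S (Suc r) n)" unfolding S_def by (rule finite_comp)
  have "complete_hom (Suc r) n w = sum g A + sum g B"
    unfolding ch un
    by (rule sum.union_disjoint) (use fin in \<open>auto simp: A_def B_def\<close>)
  also have "sum g A = complete_hom r n w"
    unfolding complete_hom_def
  proof (rule sum.reindex_bij_witness[of _ "\<lambda>m. m(Suc r := 0)" "\<lambda>m. m(Suc r := undefined)"])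
    fix m assume "m \<in> A"
    hence m: "m \<in> S (Suc r) n" "m (Suc r) = 0" by (auto simp: A_def)
    show "(m(Suc r := undefined))(Suc r := 0) = m" using m by (simp add: fun_eq_iff)
    have "(\<Sum>i=1..r. m i) = n" using m s_Suc[of m] by (simp add: S)
    thus "m(Suc r := undefined) \<in> {m \<in> {1..r} \<rightarrow>\<^sub>E UNIV. (\<Sum>i=1..r. m i) = n}"
      using m unfolding S mem_Collect_eq s_upd by (auto simp: PiE_iff extensional_def)
    show "(\<Prod>i=1..r. w i ^ (m(Suc r := undefined)) i) = g m"
      unfolding p_upd g_def using m by simp
  next
    fix m assume "m \<in> {m \<in> {1..r} \<rightarrow>\<^sub>E (UNIV :: nat set). (\<Sum>i=1..r. m i) = n}"
    hence "m \<in> S r n" by (simp add: S_def)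
    hence m: "\<And>i. i \<notin> {1..r} \<Longrightarrow> m i = undefined" "(\<Sum>i=1..r. m i) = n" unfolding S by auto
    show "(m(Suc r := 0))(Suc r := undefined) = m" using m(1) by (simp add: fun_eq_iff)
    show "m(Suc r := 0) \<in> A"
      unfolding A_def mem_Collect_eq S s_Suc s_upd using m by auto
  qed
  also have "sum g B = (if n = 0 then 0 else w (Suc r) * complete_hom (Suc r) (n - 1) w)"
  proof (cases n)
    case 0
    have "m (Suc r) = 0" if "m \<in> S (Suc r) n" for m
      using that s_Suc[of m] 0 by (simp add: S)
    hence "B = {}" by (auto simp: B_def)
    thus ?thesis using 0 by simp
  next
    case (Suc n')
    have "sum g B = (\<Sum>m\<in>S (Suc r) n'. w (Suc r) * g m)"
    proof (rule sum.reindex_bij_witness[of _ "\<lambda>m. m(Suc r := Suc (m (Suc r)))"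
            "\<lambda>m. m(Suc r := m (Suc r) - 1)"])
      fix m assume "m \<in> B"
      hence m: "m \<in> S (Suc r) n" "m (Suc r) \<noteq> 0" by (auto simp: B_def)
      show "(m(Suc r := m (Suc r) - 1))
              (Suc r := Suc ((m(Suc r := m (Suc r) - 1)) (Suc r))) = m"
        using m(2) by (simp add: fun_eq_iff)
      show "m(Suc r := m (Suc r) - 1) \<in> S (Suc r) n'"
        using m Suc unfolding S s_Suc s_upd by auto
      obtain k where "m (Suc r) = Suc k" using m(2) by (cases "m (Suc r)") auto
      thus "w (Suc r) * g (m(Suc r := m (Suc r) - 1)) = g m"
        unfolding g_def p_upd by (simp add: mult_ac)
    next
      fix m assume m: "m \<in> S (Suc r) n'"
      show "(m(Suc r := Suc (m (Suc r))))
              (Suc r := (m(Suc r := Suc (m (Suc r)))) (Suc r) - 1) = m"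
        by (simp add: fun_eq_iff)
      show "m(Suc r := Suc (m (Suc r))) \<in> B"
        using m Suc unfolding B_def mem_Collect_eq S s_Suc s_upd by auto
    qed
    thus ?thesis using Suc by (simp add: ch sum_distrib_left)
  qed
  finally show ?thesis .
qed

lemma complete_hom_eq_schur:
  fixes w :: "nat \<Rightarrow> 'a::field"
  assumes "r \<ge> 1" "inj_on w {1..r}"
  shows "complete_hom r n w = schur r (\<lambda>j. if j = 1 then int n else 0) w"
proof -
  have ch0: "complete_hom 0 k w = (if k = 0 then 1 else 0)" for k
    by (simp add: complete_hom_def)
  have "complete_hom (Suc k) n w = schur (Suc k) (\<lambda>j. if j = 1 then int n else 0) w"
    if "inj_on w {1..Suc k}" for k
    using that
  proof (induction k arbitrary: n)
    case 0
    have "complete_hom (Suc 0) n w = w 1 ^ n"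
    proof (induction n)
      case 0
      show ?case by (subst complete_hom_Suc) (simp add: ch0)
    next
      case (Suc n)
      thus ?case by (subst complete_hom_Suc) (simp add: ch0)
    qed
    thus ?case unfolding schur_row[OF 0, of "int n"] by simp
  next
    case (Suc k)
    have i1: "inj_on w {1..Suc k}" by (rule inj_on_subset[OF Suc.prems]) auto
    note IH = Suc.IH[OF i1] and prems = Suc.prems
    show ?case
    proof (induction n)
      case 0
      have m: "int 0 - 1 = - 1" by simp
      have "complete_hom (Suc (Suc k)) 0 w = complete_hom (Suc k) 0 w"
        by (subst complete_hom_Suc) simp
      also have "\<dots> = schur (Suc (Suc k)) (\<lambda>j. if j = 1 then int 0 else 0) w"
        unfolding IH
        by (subst schur_row_Suc[OF prems]) (simp, simp only: m schur_row_minus_one, simp)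
      finally show ?case .
    next
      case (Suc n)
      have m: "int (Suc n) - 1 = int n" by simp
      have "complete_hom (Suc (Suc k)) (Suc n) w
          = complete_hom (Suc k) (Suc n) w + w (Suc (Suc k)) * complete_hom (Suc (Suc k)) n w"
        by (subst complete_hom_Suc) simp
      also have "\<dots> = schur (Suc (Suc k)) (\<lambda>j. if j = 1 then int (Suc n) else 0) w"
        unfolding IH Suc.IH
        by (subst schur_row_Suc[OF prems, of "int (Suc n)"]) (simp, simp only: m)
      finally show ?case .
    qed
  qed
  from this[of "r - 1"] assms show ?thesis by simp
qed

lemma F_seq_eq_complete_hom:
  assumes "r \<ge> 1"
  shows "F_seq r (int n + 1) = complete_hom r n (alpha r)"
  unfolding F_seq_def complete_hom_eq_schur[OF assms alpha_inj_on]
  by (simp only: add_diff_cancel_right')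

end

theory Submission
  imports Defs
begin

text \<open>
  Put \<open>N = 2r + 1\<close>. Both sequences are fixed linear combinations of the \<open>r\<close> bilateral geometric
  sequences \<open>\<alpha>\<^sub>i\<^sup>n\<close>: for \<open>L\<close> this is the definition, for \<open>F\<close> it is the expansion of the determinant
  along its first column (\<open>schur_row\<close>). So the recursion holds for both as soon as its
  characteristic polynomial vanishes at every \<open>\<alpha>\<^sub>i\<close> (\<open>recursion_of_root\<close>).

  The binomial sums in the recursion are those of the Chebyshev polynomials of the second kind in
  the normalisation \<open>U\<^sub>k(2 cos \<phi>) = sin ((k + 1) \<phi>) / sin \<phi>\<close>. The first sum is \<open>U\<^sub>r\<^sub>-\<^sub>1\<close>, and the
  second one, moved to the left, completes \<open>x\<^sup>r\<close> to \<open>U\<^sub>r\<close>; hence the characteristic equation reads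
  \<open>U\<^sub>r(x) = U\<^sub>r\<^sub>-\<^sub>1(x)\<close>. Now \<open>\<alpha>\<^sub>i = 2 cos \<phi>\<close> with \<open>\<phi> = \<pi> - 2\<pi>i/N\<close>, and \<open>N\<phi>\<close> is an odd multiple of \<open>\<pi>\<close>,
  so \<open>sin ((r + 1) \<phi>) = sin (r \<phi>)\<close>.

  The initial zeros of \<open>F\<close> come from two equal columns in the determinant. The initial values of
  \<open>L\<close> come from discrete Fourier orthogonality. With \<open>\<omega> = exp (2\<pi>i/N)\<close> one has
  \<open>-\<alpha>\<^sub>k = \<omega>\<^sup>k + \<omega>\<^sup>-\<^sup>k\<close>. Expanding the \<open>n\<close>-th power and summing over all residues \<open>k\<close> modulo \<open>N\<close>
  retains, for \<open>n < N\<close>, only the central binomial term, which exists for even \<open>n\<close>. The residue \<open>0\<close>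
  contributes \<open>2\<^sup>n\<close>, and the others come in pairs \<open>\<plusminus>k\<close>, whose values occur twice.
\<close>

section \<open>The characteristic equation\<close>

text \<open>The classical Chebyshev polynomial of the second kind at \<open>x / 2\<close>. The sum may run over all
  \<open>j \<le> k\<close>: the binomial coefficient vanishes as soon as \<open>2 * j > k\<close>, where truncated subtraction
  falsifies the exponent.\<close>

definition chebyshev_U :: "nat \<Rightarrow> 'a::comm_ring_1 \<Rightarrow> 'a" where
  "chebyshev_U k x = (\<Sum>j\<le>k. (- 1) ^ j * of_nat ((k - j) choose j) * x ^ (k - 2 * j))"

lemma chebyshev_U_half_range:
  "chebyshev_U k x = (\<Sum>j | 2 * j \<le> k. (- 1) ^ j * of_nat ((k - j) choose j) * x ^ (k - 2 * j))"
  unfolding chebyshev_U_def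
  by (rule sum.mono_neutral_right) (auto, rule ccontr, simp add: binomial_eq_0)

text \<open>Once \<open>j = 0\<close> is split off, the remaining terms are those of the second sum of the recursion.\<close>

lemma chebyshev_U_Suc:
  "chebyshev_U (Suc k) x = x ^ Suc k
     - (\<Sum>j\<le>k. (- 1) ^ j * of_nat ((k - j) choose Suc j) * x ^ (Suc k - 2 * Suc j))"
  unfolding chebyshev_U_def sum.atMost_Suc_shift by (simp add: sum_negf)

text \<open>This is Pascal's rule for the coefficients of equal powers of \<open>x\<close>.\<close>

lemma chebyshev_U_recurrence:
  "chebyshev_U (Suc (Suc k)) x = x * chebyshev_U (Suc k) x - chebyshev_U k x"
proof -
  let ?s = "\<lambda>j. (- 1) ^ j :: 'a"
  have "chebyshev_U (Suc (Suc k)) x = x ^ Suc (Suc k)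
      - (\<Sum>j\<le>k. ?s j * of_nat ((Suc k - j) choose Suc j) * x ^ (k - 2 * j))"
    by (simp add: chebyshev_U_Suc)
  also have "(\<Sum>j\<le>k. ?s j * of_nat ((Suc k - j) choose Suc j) * x ^ (k - 2 * j))
      = (\<Sum>j\<le>k. ?s j * of_nat ((k - j) choose j) * x ^ (k - 2 * j)
          + x * (?s j * of_nat ((k - j) choose Suc j) * x ^ (Suc k - 2 * Suc j)))"
  proof (rule sum.cong[OF refl])
    fix j assume j: "j \<in> {..k}"
    have b: "(Suc k - j) choose Suc j = ((k - j) choose j) + ((k - j) choose Suc j)"
      using j by (simp add: Suc_diff_le)
    show "?s j * of_nat ((Suc k - j) choose Suc j) * x ^ (k - 2 * j)
        = ?s j * of_nat ((k - j) choose j) * x ^ (k - 2 * j)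
          + x * (?s j * of_nat ((k - j) choose Suc j) * x ^ (Suc k - 2 * Suc j))"
    proof (cases "Suc (2 * j) \<le> k")
      case True
      hence "k - 2 * j = Suc (Suc k - 2 * Suc j)" by simp
      hence "x ^ (k - 2 * j) = x * x ^ (Suc k - 2 * Suc j)" by (metis power_Suc)
      thus ?thesis unfolding b by (simp add: algebra_simps)
    next
      case False
      \<comment> \<open>Here the exponent \<open>Suc k - 2 * Suc j\<close> is truncated, but its coefficient is zero.\<close>
      hence "(k - j) choose Suc j = 0" by (intro binomial_eq_0) simp
      thus ?thesis unfolding b by (simp only: of_nat_0 add_0_right mult_zero_left mult_zero_right)
    qed
  qed
  also have "\<dots> = chebyshev_U k x
      + x * (\<Sum>j\<le>k. ?s j * of_nat ((k - j) choose Suc j) * x ^ (Suc k - 2 * Suc j))"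
    unfolding chebyshev_U_def sum.distrib sum_distrib_left ..
  also have "x ^ Suc (Suc k) - \<dots> = x * chebyshev_U (Suc k) x - chebyshev_U k x"
    unfolding chebyshev_U_Suc by (simp add: algebra_simps)
  finally show ?thesis .
qed

text \<open>Both sides obey the same three-term recurrence, by
  \<open>sin (a + t) + sin (a - t) = 2 cos t sin a\<close>.\<close>

lemma sin_times_chebyshev_U:
  fixes t :: real
  shows "sin t * chebyshev_U k (2 * cos t) = sin (real (Suc k) * t)"
proof (induction k rule: induct_nat_012)
  case 0
  show ?case by (simp add: chebyshev_U_def)
next
  case 1
  show ?case by (simp add: chebyshev_U_def sin_double)
next
  case (ge2 k)
  let ?a = "real (Suc (Suc k)) * t"
  have "sin t * chebyshev_U (Suc (Suc k)) (2 * cos t)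
      = 2 * cos t * (sin t * chebyshev_U (Suc k) (2 * cos t)) - sin t * chebyshev_U k (2 * cos t)"
    unfolding chebyshev_U_recurrence by (simp add: algebra_simps)
  also have "\<dots> = 2 * cos t * sin ?a - sin (?a - t)"
    unfolding ge2.IH by (simp add: algebra_simps)
  also have "\<dots> = sin (?a + t)"
    unfolding sin_add sin_diff by simp
  finally show ?case by (simp add: algebra_simps)
qed

text \<open>With \<open>alpha r i = 2 * cos t\<close> and \<open>0 < t < pi\<close>, the two sides are \<open>sin ((r + 1) t) / sin t\<close> and
  \<open>sin (r t) / sin t\<close>. The two angles add up to an odd multiple of \<open>pi\<close>, so their sines agree.\<close>

lemma chebyshev_U_alpha:
  assumes "i \<in> {1..r}"
  shows "chebyshev_U r (alpha r i) = chebyshev_U (r - 1) (alpha r i)"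
proof -
  define N where "N = 2 * real r + 1"
  define t where "t = pi - 2 * pi * real i / N"
  have N: "N > 0" by (simp add: N_def)
  have r: "Suc (r - 1) = r" using assms by simp
  have a: "alpha r i = 2 * cos t"
    by (simp add: alpha_def t_def N_def cos_diff)
  have Nt: "N * t = (2 * real r + 1) * pi - 2 * pi * real i"
    using N by (simp add: t_def field_simps N_def)
  have "2 * real i / N < 1" using N assms by (simp add: N_def)
  hence "pi * (2 * real i / N) < pi * 1" by (intro mult_strict_left_mono) auto
  moreover have "2 * pi * real i / N > 0" using N assms by simp
  ultimately have "0 < t" "t < pi" by (auto simp: t_def mult_ac)
  hence s: "sin t \<noteq> 0" using sin_gt_zero[of t] by simp
  have "real (Suc r) * t = (pi + (2 * pi * real r - 2 * pi * real i)) - real r * t"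
    using Nt by (simp add: N_def algebra_simps)
  also have "sin \<dots> = sin (pi - real r * t + 2 * pi * of_int (int r - int i))"
    by (simp add: algebra_simps)
  also have "\<dots> = sin (pi - real r * t)"
    unfolding sin_add using sin_int_2pin cos_int_2pin by (simp only: mult_1_right mult_zero_right add_0_right)
  also have "\<dots> = sin (real r * t)" by simp
  finally have "sin t * chebyshev_U r (2 * cos t) = sin t * chebyshev_U (r - 1) (2 * cos t)"
    unfolding sin_times_chebyshev_U r .
  thus ?thesis using s a by simp
qed

section \<open>The recursion for combinations of powers\<close>

text \<open>The upper summation limit \<open>\<lfloor>(r - 2) / 2\<rfloor>\<close> is \<open>-1\<close> for \<open>r = 1\<close>, in agreement with the empty set
  on the right.\<close>

lemma floor_half_range:
  "{j::nat. int j \<le> \<lfloor>(real r - real c) / 2\<rfloor>} = {j. 2 * j + c \<le> r}"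
proof (rule Collect_cong)
  fix j :: nat
  have "int j \<le> \<lfloor>(real r - real c) / 2\<rfloor> \<longleftrightarrow> real (2 * j + c) \<le> real r"
    by (simp add: le_floor_iff field_simps)
  thus "int j \<le> \<lfloor>(real r - real c) / 2\<rfloor> \<longleftrightarrow> 2 * j + c \<le> r"
    by (simp only: of_nat_le_iff)
qed

lemma power_eq_of_chebyshev_U_eq:
  fixes x :: "'a::comm_ring_1"
  assumes "r \<ge> 1" "chebyshev_U r x = chebyshev_U (r - 1) x"
  shows "x ^ r = (\<Sum>j | 2 * j + 1 \<le> r. (- 1) ^ j * of_nat ((r - 1 - j) choose j) * x ^ (r - 1 - 2 * j))
    + (\<Sum>j | 2 * j + 2 \<le> r. (- 1) ^ j * of_nat ((r - 1 - j) choose (j + 1)) * x ^ (r - 2 - 2 * j))"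
proof -
  obtain k where k: "r = Suc k" using assms(1) by (cases r) auto
  have "(\<Sum>j\<le>k. (- 1) ^ j * of_nat ((k - j) choose Suc j) * x ^ (Suc k - 2 * Suc j))
      = (\<Sum>j | 2 * j + 2 \<le> r. (- 1) ^ j * of_nat ((k - j) choose Suc j) * x ^ (Suc k - 2 * Suc j))"
    by (rule sum.mono_neutral_right) (auto simp: k, rule ccontr, simp add: binomial_eq_0)
  hence "x ^ r = chebyshev_U r x
      + (\<Sum>j | 2 * j + 2 \<le> r. (- 1) ^ j * of_nat ((k - j) choose Suc j) * x ^ (Suc k - 2 * Suc j))"
    unfolding k chebyshev_U_Suc by simp
  thus ?thesis
    unfolding assms(2) by (simp add: k chebyshev_U_half_range)
qed

text \<open>The characteristic equation is multiplied by \<open>x powi n\<close>. For negative \<open>n\<close> this relies on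
  \<open>x \<noteq> 0\<close>.\<close>

lemma recursion_of_root:
  fixes x :: "'a::field"
  assumes "r \<ge> 1" "x \<noteq> 0" "chebyshev_U r x = chebyshev_U (r - 1) x"
  shows "x powi (n + int r)
    = (\<Sum>j | 2 * j + 1 \<le> r. (- 1) ^ j * of_nat ((r - 1 - j) choose j) * x powi (n + int r - 1 - 2 * int j))
    + (\<Sum>j | 2 * j + 2 \<le> r. (- 1) ^ j * of_nat ((r - 1 - j) choose (j + 1)) * x powi (n + int r - 2 - 2 * int j))"
proof -
  have e: "x powi n * x ^ (r - c - 2 * j) = x powi (n + int r - int c - 2 * int j)"
    if "2 * j + c \<le> r" for c j
  proof -
    have "n + int r - int c - 2 * int j = n + int (r - c - 2 * j)" using that by simp
    thus ?thesis using assms(2) by (simp only: power_int_add power_int_of_nat simp_thms)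
  qed
  have "x powi (n + int r) = x powi n * x ^ r"
    using assms(2) by (simp add: power_int_add)
  also have "\<dots> = (\<Sum>j | 2 * j + 1 \<le> r. (- 1) ^ j * of_nat ((r - 1 - j) choose j) * (x powi n * x ^ (r - 1 - 2 * j)))
    + (\<Sum>j | 2 * j + 2 \<le> r. (- 1) ^ j * of_nat ((r - 1 - j) choose (j + 1)) * (x powi n * x ^ (r - 2 - 2 * j)))"
    by (subst power_eq_of_chebyshev_U_eq[OF assms(1,3)])
       (simp add: distrib_left sum_distrib_left mult_ac)
  also have "\<dots> = (\<Sum>j | 2 * j + 1 \<le> r. (- 1) ^ j * of_nat ((r - 1 - j) choose j) * x powi (n + int r - 1 - 2 * int j))
    + (\<Sum>j | 2 * j + 2 \<le> r. (- 1) ^ j * of_nat ((r - 1 - j) choose (j + 1)) * x powi (n + int r - 2 - 2 * int j))"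
    using e[of _ 1] e[of _ 2] by (intro arg_cong2[of _ _ _ _ "(+)"] sum.cong) auto
  finally show ?thesis .
qed

lemma recursion_of_combination:
  fixes a :: "int \<Rightarrow> real"
  assumes "r \<ge> 1" and a: "\<And>n. a n = (\<Sum>i=1..r. c i * alpha r i powi n)"
  shows "a (n + int r)
    = (\<Sum>j\<in>{j::nat. int j \<le> \<lfloor>(real r - 1) / 2\<rfloor>}.
        (- 1) ^ j * real ((r - 1 - j) choose j) * a (n + int r - 1 - 2 * int j))
    + (\<Sum>j\<in>{j::nat. int j \<le> \<lfloor>(real r - 2) / 2\<rfloor>}.
        (- 1) ^ j * real ((r - 1 - j) choose (j + 1)) * a (n + int r - 2 - 2 * int j))"
proof -
  have range: "{j::nat. int j \<le> \<lfloor>(real r - 1) / 2\<rfloor>} = {j. 2 * j + 1 \<le> r}"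
    "{j::nat. int j \<le> \<lfloor>(real r - 2) / 2\<rfloor>} = {j. 2 * j + 2 \<le> r}"
    using floor_half_range[of r 1] floor_half_range[of r 2] by simp_all
  have swap: "(\<Sum>i=1..r. c i * (\<Sum>j\<in>J. b j * alpha r i powi e j)) = (\<Sum>j\<in>J. b j * a (e j))"
    for J :: "nat set" and b e
    unfolding a sum_distrib_left by (subst sum.swap) (simp only: mult.left_commute)
  have "a (n + int r) = (\<Sum>i=1..r. c i * alpha r i powi (n + int r))" by (rule a)
  also have "\<dots> = (\<Sum>i=1..r. c i *
      ((\<Sum>j | 2 * j + 1 \<le> r. (- 1) ^ j * real ((r - 1 - j) choose j)
          * alpha r i powi (n + int r - 1 - 2 * int j))
      + (\<Sum>j | 2 * j + 2 \<le> r. (- 1) ^ j * real ((r - 1 - j) choose (j + 1))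
          * alpha r i powi (n + int r - 2 - 2 * int j))))"
    using recursion_of_root[OF assms(1) alpha_nonzero chebyshev_U_alpha]
    by (intro sum.cong) auto
  finally show ?thesis
    unfolding distrib_left sum.distrib swap range .
qed

lemma F_seq_eq_combination:
  assumes "r \<ge> 1"
  obtains c where "\<And>n. F_seq r (n + 1) = (\<Sum>i=1..r. c i * alpha r i powi n)"
proof
  fix n
  obtain k where k: "r = Suc k" using assms by (cases r) auto
  have "F_seq r (n + 1)
      = (\<Sum>i=1..r. alpha r i powi (n + int k) / (\<Prod>j\<in>{1..r} - {i}. alpha r i - alpha r j))"
    unfolding F_seq_def add_diff_cancel_right' k by (rule schur_row[OF alpha_inj_on])
  also have "\<dots> = (\<Sum>i=1..r. (alpha r i ^ (r - 1) / (\<Prod>j\<in>{1..r} - {i}. alpha r i - alpha r j))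
      * alpha r i powi n)"
    by (simp add: power_int_add alpha_nonzero k mult.commute)
  finally show "F_seq r (n + 1) = \<dots>" .
qed

section \<open>Initial values\<close>

lemma complete_hom_zero: "complete_hom r 0 w = 1"
proof (induction r)
  case 0
  show ?case by (simp add: complete_hom_def)
next
  case (Suc r)
  thus ?case by (subst complete_hom_Suc) simp
qed

text \<open>The first column of the determinant has the exponent \<open>r - 1 - i\<close>, and so has the one with
  index \<open>i\<close>, counted from \<open>0\<close>.\<close>

lemma schur_row_negative:
  fixes w :: "nat \<Rightarrow> 'a::field"
  assumes "1 \<le> i" "i < r"
  shows "schur r (\<lambda>j. if j = 1 then - int i else 0) w = 0"
proof -
  have "det (mat r r (\<lambda>(i', j). w (i' + 1) powi
      ((if j + 1 = 1 then - int i else 0) + int r - int (j + 1)))) = 0"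
    by (rule det_identical_columns[of _ r 0 i]) (use assms in \<open>auto intro!: eq_vecI simp: algebra_simps\<close>)
  thus ?thesis unfolding schur_def by simp
qed

text \<open>The terms are the powers of \<open>z = cis (2 * pi * d / N)\<close>. As \<open>z ^ N = 1\<close>, this geometric sum
  vanishes unless \<open>z = 1\<close>.\<close>

lemma sum_roots_of_unity_power:
  fixes d :: int
  assumes "N > 0"
  shows "(\<Sum>k<N. cis (2 * pi * real k / real N * of_int d)) = (if int N dvd d then of_nat N else 0)"
proof -
  define z where "z = cis (2 * pi * of_int d / real N)"
  have term_eq: "cis (2 * pi * real k / real N * of_int d) = z ^ k" for k
    by (simp add: z_def Complex.DeMoivre mult_ac)
  have one_iff: "z = 1 \<longleftrightarrow> int N dvd d"
  proof
    assume "z = 1"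
    hence "cos (2 * pi * of_int d / real N) = 1" by (simp add: z_def complex_eq_iff)
    then obtain q :: int where "2 * pi * of_int d / real N = of_int q * 2 * pi"
      by (auto simp: cos_one_2pi_int)
    hence "of_int d = (of_int (q * int N) :: real)" using assms by (simp add: field_simps)
    hence "d = q * int N" by (simp only: of_int_eq_iff)
    thus "int N dvd d" by simp
  next
    assume "int N dvd d"
    then obtain q where "d = int N * q" by (auto elim: dvdE)
    hence "2 * pi * of_int d / real N = 2 * pi * of_int q" using assms by simp
    thus "z = 1" unfolding z_def by (simp only: cis_multiple_2pi Ints_of_int)
  qed
  have "z ^ N = cis (2 * pi * of_int d)"
    using assms by (simp add: z_def Complex.DeMoivre)
  hence zN: "z ^ N = 1" by (simp add: cis_multiple_2pi)
  show ?thesis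
  proof (cases "z = 1")
    case True
    thus ?thesis unfolding term_eq using one_iff by simp
  next
    case False
    thus ?thesis unfolding term_eq using one_iff zN by (simp add: geometric_sum)
  qed
qed

text \<open>For \<open>n < N\<close> the frequencies \<open>n - 2 * i\<close> of the expansion have absolute value below \<open>N\<close>, so the
  only one divisible by \<open>N\<close> is \<open>0\<close>.\<close>

lemma sum_cos_power_full_period:
  assumes "n < N"
  shows "(\<Sum>k<N. (2 * cos (2 * pi * real k / real N)) ^ n)
    = (if even n then real N * real (n choose (n div 2)) else 0)"
proof -
  let ?t = "\<lambda>k. 2 * pi * real k / real N"
  have expand: "complex_of_real ((2 * cos t) ^ n)
      = (\<Sum>i\<le>n. of_nat (n choose i) * cis (t * of_int (2 * int i - int n)))" for t
  proof -
    have "complex_of_real (2 * cos t) = cis t + cis (- t)"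
      by (simp add: complex_eq_iff)
    hence "complex_of_real ((2 * cos t) ^ n) = (cis t + cis (- t)) ^ n"
      by (simp only: of_real_power)
    also have "\<dots> = (\<Sum>i\<le>n. of_nat (n choose i) * cis t ^ i * cis (- t) ^ (n - i))"
      by (rule binomial_ring)
    also have "\<dots> = (\<Sum>i\<le>n. of_nat (n choose i) * cis (t * of_int (2 * int i - int n)))"
      by (rule sum.cong) (auto simp: Complex.DeMoivre cis_mult mult.assoc of_nat_diff algebra_simps)
    finally show ?thesis .
  qed
  have dvd: "int N dvd (2 * int i - int n) \<longleftrightarrow> 2 * i = n" if "i \<le> n" for i
  proof
    assume "int N dvd (2 * int i - int n)"
    moreover have "\<bar>2 * int i - int n\<bar> < int N" using that assms by auto
    ultimately have "2 * int i - int n = 0" by (metis zdvd_not_zless abs_of_nonneg abs_ge_zero dvd_abs_iff zero_less_abs_iff)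
    thus "2 * i = n" by simp
  qed auto
  have "complex_of_real (\<Sum>k<N. (2 * cos (?t k)) ^ n)
      = (\<Sum>k<N. \<Sum>i\<le>n. of_nat (n choose i) * cis (?t k * of_int (2 * int i - int n)))"
    by (simp only: of_real_sum expand)
  also have "\<dots> = (\<Sum>i\<le>n. of_nat (n choose i) * (\<Sum>k<N. cis (?t k * of_int (2 * int i - int n))))"
    by (subst sum.swap) (simp only: sum_distrib_left)
  also have "\<dots> = (\<Sum>i\<le>n. if 2 * i = n then of_nat (n choose i) * of_nat N else 0)"
  proof (rule sum.cong[OF refl])
    fix i assume "i \<in> {..n}"
    thus "of_nat (n choose i) * (\<Sum>k<N. cis (?t k * of_int (2 * int i - int n)))
        = (if 2 * i = n then of_nat (n choose i) * of_nat N else 0)"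
      using assms by (subst sum_roots_of_unity_power) (auto simp: dvd)
  qed
  also have "\<dots> = (if even n then of_nat N * of_nat (n choose (n div 2)) else 0)"
  proof (cases "even n")
    case True
    then obtain m where "n = 2 * m" by (auto elim: evenE)
    thus ?thesis by (simp add: mult_ac)
  next
    case False
    hence "2 * i \<noteq> n" for i by auto
    thus ?thesis using False by simp
  qed
  also have "\<dots> = complex_of_real (if even n then real N * real (n choose (n div 2)) else 0)"
    by simp
  finally show ?thesis by (simp only: of_real_eq_iff)
qed

text \<open>The residues \<open>k\<close> and \<open>-k\<close> modulo \<open>2 * r + 1\<close> share the same cosine, and only \<open>0\<close> is its own
  negative, because the modulus is odd.\<close>

lemma sum_cos_odd_period:
  fixes f :: "real \<Rightarrow> real"
  shows "(\<Sum>k<2 * r + 1. f (cos (2 * pi * real k / real (2 * r + 1))))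
    = f 1 + 2 * (\<Sum>k=1..r. f (cos (2 * pi * real k / real (2 * r + 1))))"
proof -
  let ?g = "\<lambda>k. f (cos (2 * pi * real k / real (2 * r + 1)))"
  have sym: "?g (2 * r + 1 - k) = ?g k" if "k \<le> r" for k
  proof -
    have "2 * pi * real (2 * r + 1 - k) / real (2 * r + 1)
        = 2 * pi - 2 * pi * real k / real (2 * r + 1)"
      using that by (simp add: of_nat_diff field_simps)
    thus ?thesis by (simp only: cos_2pi_minus)
  qed
  have split: "{..<2 * r + 1} = insert 0 ({1..r} \<union> {r+1..2 * r})" by auto
  have "(\<Sum>k\<in>{r+1..2 * r}. ?g k) = (\<Sum>k=1..r. ?g k)"
    by (rule sum.reindex_bij_witness[of _ "\<lambda>k. 2 * r + 1 - k" "\<lambda>k. 2 * r + 1 - k"])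
       (use sym[symmetric] in \<open>auto simp del: of_nat_diff\<close>)
  moreover have "(\<Sum>k<2 * r + 1. ?g k) = ?g 0 + ((\<Sum>k=1..r. ?g k) + (\<Sum>k\<in>{r+1..2 * r}. ?g k))"
    unfolding split by (subst sum.insert) (auto simp: sum.union_disjoint)
  ultimately show ?thesis by simp
qed

lemma L_seq_initial:
  assumes "n < 2 * r + 1"
  shows "2 * L_seq r (int n)
    = (if even n then real (2 * r + 1) * real (n choose (n div 2)) else 0) - (- 2) ^ n"
proof -
  let ?S = "\<Sum>k=1..r. (2 * cos (2 * pi * real k / real (2 * r + 1))) ^ n"
  have "2 ^ n + 2 * ?S = (if even n then real (2 * r + 1) * real (n choose (n div 2)) else 0)"
    using sum_cos_power_full_period[OF assms]
    unfolding sum_cos_odd_period[of "\<lambda>y. (2 * y) ^ n"] by simp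
  moreover have "L_seq r (int n) = (- 1) ^ n * ?S"
  proof -
    have "alpha r k ^ n = (- 1) ^ n * (2 * cos (2 * pi * real k / real (2 * r + 1))) ^ n" for k
      unfolding power_mult_distrib[symmetric] by (simp add: alpha_def add.commute)
    thus ?thesis by (simp add: L_seq_def sum_distrib_left)
  qed
  ultimately show ?thesis by (cases "even n") auto
qed

theorem theorem5:
  fixes r :: nat
  assumes "r \<ge> 1"
  shows "F_seq r 1 = 1 \<and>
    (\<forall>i::int. 0 \<le> i \<and> i \<le> int r - 2 \<longrightarrow> F_seq r (- i) = 0) \<and>
    (\<forall>m::nat. 2 * m \<le> r - 1 \<longrightarrow>
       L_seq r (int (2 * m)) =
         - (2 powi (2 * int m - 1)) + (2 * real r + 1) / 2 * real ((2 * m) choose m)) \<and>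
    (\<forall>m::nat. 2 * m + 1 \<le> r - 1 \<longrightarrow> L_seq r (int (2 * m + 1)) = 4 ^ m) \<and>
    (\<forall>a \<in> {\<lambda>n. F_seq r (n + 1), L_seq r}. \<forall>n::int.
       a (n + int r) =
         (\<Sum>j\<in>{j::nat. int j \<le> \<lfloor>(real r - 1) / 2\<rfloor>}.
            (- 1) ^ j * real ((r - 1 - j) choose j) * a (n + int r - 1 - 2 * int j))
       + (\<Sum>j\<in>{j::nat. int j \<le> \<lfloor>(real r - 2) / 2\<rfloor>}.
            (- 1) ^ j * real ((r - 1 - j) choose (j + 1)) * a (n + int r - 2 - 2 * int j)))"
proof (intro conjI allI impI ballI)
  show "F_seq r 1 = 1"
    using F_seq_eq_complete_hom[OF assms, of 0] by (simp add: complete_hom_zero)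
next
  fix i :: int assume i: "0 \<le> i \<and> i \<le> int r - 2"
  define d where "d = nat (i + 1)"
  have "- i - 1 = - int d" "1 \<le> d" "d < r" using i by (auto simp: d_def)
  thus "F_seq r (- i) = 0"
    unfolding F_seq_def by (simp only: schur_row_negative)
next
  fix m :: nat assume "2 * m \<le> r - 1"
  hence "2 * L_seq r (int (2 * m)) = (2 * real r + 1) * real ((2 * m) choose m) - 4 ^ m"
    using L_seq_initial[of "2 * m" r] by (simp add: power_mult add.commute)
  moreover have "(2::real) powi (2 * int m - 1) = 4 ^ m / 2"
    by (simp add: power_int_diff power_int_mult)
  ultimately show "L_seq r (int (2 * m))
      = - (2 powi (2 * int m - 1)) + (2 * real r + 1) / 2 * real ((2 * m) choose m)"
    by (simp add: field_simps)
next
  fix m :: nat assume "2 * m + 1 \<le> r - 1"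
  thus "L_seq r (int (2 * m + 1)) = 4 ^ m"
    using L_seq_initial[of "2 * m + 1" r] by (simp add: power_mult)
next
  fix a :: "int \<Rightarrow> real" and n :: int
  assume a: "a \<in> {\<lambda>n. F_seq r (n + 1), L_seq r}"
  obtain c where F: "\<And>n. F_seq r (n + 1) = (\<Sum>i=1..r. c i * alpha r i powi n)"
    using F_seq_eq_combination[OF assms] by blast
  have L: "L_seq r n = (\<Sum>i=1..r. 1 * alpha r i powi n)" for n
    by (simp add: L_seq_def)
  have "\<exists>c. \<forall>n. a n = (\<Sum>i=1..r. c i * alpha r i powi n)"
  proof (cases "a = L_seq r")
    case True
    thus ?thesis using L by (intro exI[of _ "\<lambda>_. 1"]) simp
  next
    case False
    thus ?thesis using a F by (intro exI[of _ c]) simp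
  qed
  then obtain c' where "\<And>n. a n = (\<Sum>i=1..r. c' i * alpha r i powi n)" by blast
  thus "a (n + int r) =
         (\<Sum>j\<in>{j::nat. int j \<le> \<lfloor>(real r - 1) / 2\<rfloor>}.
            (- 1) ^ j * real ((r - 1 - j) choose j) * a (n + int r - 1 - 2 * int j))
       + (\<Sum>j\<in>{j::nat. int j \<le> \<lfloor>(real r - 2) / 2\<rfloor>}.
            (- 1) ^ j * real ((r - 1 - j) choose (j + 1)) * a (n + int r - 2 - 2 * int j))"
    by (rule recursion_of_combination[OF assms])
qed

end
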